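(* Let $k\ge 3$ and $m\ge 2$ be integers and let $\mathcal{H}$ be a unicyclic $k$-uniform hypergraph on $n$ vertices with $m=\frac{n}{k-1}$ edges. Then $$\log(km)-\frac{m\log m+2\log 2}{km}\;\le\; I_d^1(\mathcal{H})\;\le\;\log(km)-\frac{2\log 2}{k},$$ where equality holds in the first inequality if and only if $\mathcal{H}\cong\mathcal{H}^{II}$, and equality holds in the second inequality if and only if the maximum vertex degree of $\mathcal{H}$ is $2$.
   Context: All logarithms are to base $2$. A $k$-uniform hypergraph consists of a finite vertex set and a set of distinct edges, each a $k$-element subset of the vertex set. The degree $d_v$ of a vertex is the number of edges containing it. A walk is a sequence $v_0e_1v_1\cdots e_lv_l$ with $\{v_{i-1},v_i\}\subseteq e_i$; the hypergraph is connected if any two vertices are joined by a walk; a cycle is a walk with $l\ge2$, $v_0=v_l$ and no other repeated vertices or edges. A unicyclic hypergraph is a connected hypergraph containing exactly one cycle; equivalently, a connected $k$-uniform hypergraph with $n$ vertices and $m$ edges is unicyclic iff $m(k-1)=n$. $\mathcal{H}^{II}$ denotes the $k$-uniform hypergraph with $m$ edges $e_1,\dots,e_m$ in which a vertex $v$ lies in every edge, a second vertex $w\neq v$ lies in exactly $e_1$ and $e_2$, and every other vertex lies in exactly one edge (so its degree sequence is $m,2,1,\dots,1$). For a hypergraph with vertex degrees $d_1,\dots,d_n$ (all positive), $$I_d^1(\mathcal{H})=-\sum_{i=1}^n\frac{d_i}{\sum_{j=1}^n d_j}\log\frac{d_i}{\sum_{j=1}^n d_j}.$$ *)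

theory Defs
  imports Complex_Main
begin

text \<open>A hypergraph is given by its vertex set \<open>V\<close> and its set of edges \<open>E\<close>.\<close>

definition uniform_hypergraph :: "nat \<Rightarrow> 'a set \<Rightarrow> 'a set set \<Rightarrow> bool" where
  "uniform_hypergraph k V E \<longleftrightarrow> finite V \<and> (\<forall>e\<in>E. e \<subseteq> V \<and> card e = k)"

definition degree :: "'a set set \<Rightarrow> 'a \<Rightarrow> nat" where
  "degree E v = card {e \<in> E. v \<in> e}"

text \<open>The walk \<open>v\<^sub>0 e\<^sub>1 v\<^sub>1 \<dots> e\<^sub>l v\<^sub>l\<close> is represented by the lists
  \<open>vs = [v\<^sub>0, \<dots>, v\<^sub>l]\<close> and \<open>es = [e\<^sub>1, \<dots>, e\<^sub>l]\<close>, so that \<open>es ! i\<close> is \<open>e\<^sub>i\<^sub>+\<^sub>1\<close>.\<close>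

definition walk :: "'a set \<Rightarrow> 'a set set \<Rightarrow> 'a list \<Rightarrow> 'a set list \<Rightarrow> bool" where
  "walk V E vs es \<longleftrightarrow> length vs = Suc (length es) \<and> set vs \<subseteq> V \<and> set es \<subseteq> E \<and>
     (\<forall>i<length es. {vs ! i, vs ! Suc i} \<subseteq> es ! i)"

definition connected_hypergraph :: "'a set \<Rightarrow> 'a set set \<Rightarrow> bool" where
  "connected_hypergraph V E \<longleftrightarrow>
     (\<forall>u\<in>V. \<forall>v\<in>V. \<exists>vs es. walk V E vs es \<and> hd vs = u \<and> last vs = v)"

definition cycle :: "'a set \<Rightarrow> 'a set set \<Rightarrow> 'a list \<Rightarrow> 'a set list \<Rightarrow> bool" where
  "cycle V E vs es \<longleftrightarrow> walk V E vs es \<and> 2 \<le> length es \<and> hd vs = last vs \<and>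
     distinct (butlast vs) \<and> distinct es"

text \<open>Cycles are counted irrespective of starting vertex and direction of traversal: two
  cyclic walks are the same cycle iff they use the same vertex-edge incidences.\<close>

definition walk_incidences :: "'a list \<Rightarrow> 'a set list \<Rightarrow> ('a \<times> 'a set) set" where
  "walk_incidences vs es = (\<Union>i<length es. {(vs ! i, es ! i), (vs ! Suc i, es ! i)})"

definition unicyclic_hypergraph :: "'a set \<Rightarrow> 'a set set \<Rightarrow> bool" where
  "unicyclic_hypergraph V E \<longleftrightarrow> connected_hypergraph V E \<and>
     (\<exists>!C. \<exists>vs es. cycle V E vs es \<and> C = walk_incidences vs es)"

definition hypergraph_iso :: "'a set \<Rightarrow> 'a set set \<Rightarrow> 'b set \<Rightarrow> 'b set set \<Rightarrow> bool" where
  "hypergraph_iso V E V' E' \<longleftrightarrow> (\<exists>f. bij_betw f V V' \<and> (\<lambda>e. f ` e) ` E = E')"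

definition degree_entropy :: "'a set \<Rightarrow> 'a set set \<Rightarrow> real" where
  "degree_entropy V E =
     - (\<Sum>v\<in>V. real (degree E v) / (\<Sum>u\<in>V. real (degree E u)) *
          log 2 (real (degree E v) / (\<Sum>u\<in>V. real (degree E u))))"

text \<open>A concrete model of \<open>\<H>\<^sup>I\<^sup>I\<close> (for \<open>k \<ge> 3\<close>, \<open>m \<ge> 2\<close>): \<open>Hub\<close> is the vertex \<open>v\<close> lying in
  all edges, \<open>Twin\<close> the vertex \<open>w\<close> lying in exactly the edges 1 and 2, and \<open>Private i j\<close> are
  the vertices of degree one in edge \<open>i\<close>.\<close>

datatype HII_vertex = Hub | Twin | Private nat nat

definition HII_edge :: "nat \<Rightarrow> nat \<Rightarrow> HII_vertex set" where
  "HII_edge k i =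
     (if i \<in> {1, 2} then {Hub, Twin} \<union> Private i ` {..<k - 2}
      else {Hub} \<union> Private i ` {..<k - 1})"

definition HII_edges :: "nat \<Rightarrow> nat \<Rightarrow> HII_vertex set set" where
  "HII_edges k m = HII_edge k ` {1..m}"

definition HII_vertices :: "nat \<Rightarrow> nat \<Rightarrow> HII_vertex set" where
  "HII_vertices k m = \<Union> (HII_edges k m)"

lemma inj_HII_edge:
  assumes "k \<ge> 3"
  shows "inj (HII_edge k)"
proof (rule injI)
  fix i j assume eq: "HII_edge k i = HII_edge k j"
  have "Private i 0 \<in> HII_edge k i" using assms by (auto simp: HII_edge_def)
  then have "Private i 0 \<in> HII_edge k j" using eq by simp
  then show "i = j" by (auto simp: HII_edge_def split: if_splits)
qed

lemma card_HII_edges: "k \<ge> 3 \<Longrightarrow> card (HII_edges k m) = m"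
  by (simp add: HII_edges_def card_image inj_on_subset[OF inj_HII_edge])

lemma uniform_hypergraph_HII:
  assumes "k \<ge> 3"
  shows "uniform_hypergraph k (HII_vertices k m) (HII_edges k m)"
proof -
  have *: "card (Private i ` A) = card A" for i A
    by (rule card_image) (auto simp: inj_on_def)
  have "card (HII_edge k i) = k" for i
  proof -
    have "card ({Hub, Twin} \<union> Private i ` {..<k - 2}) = k"
      using assms by (subst card_Un_disjoint) (auto simp: *)
    moreover have "card ({Hub} \<union> Private i ` {..<k - 1}) = k"
      using assms by (subst card_Un_disjoint) (auto simp: *)
    ultimately show ?thesis by (simp add: HII_edge_def)
  qed
  moreover have "finite (HII_edge k i)" for i by (simp add: HII_edge_def)
  ultimately show ?thesis
    by (auto simp: uniform_hypergraph_def HII_vertices_def HII_edges_def)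
qed

lemma degree_HII:
  assumes "k \<ge> 3" "m \<ge> 2"
  shows "degree (HII_edges k m) Hub = m"
    and "{e \<in> HII_edges k m. Twin \<in> e} = {HII_edge k 1, HII_edge k 2}"
    and "degree (HII_edges k m) Twin = 2"
    and "Private i j \<in> HII_vertices k m \<Longrightarrow> degree (HII_edges k m) (Private i j) = 1"
proof -
  have "{e \<in> HII_edges k m. Hub \<in> e} = HII_edges k m"
    by (auto simp: HII_edges_def HII_edge_def)
  then show "degree (HII_edges k m) Hub = m"
    using assms by (simp add: degree_def card_HII_edges)
  show T: "{e \<in> HII_edges k m. Twin \<in> e} = {HII_edge k 1, HII_edge k 2}"
    using assms by (auto simp: HII_edges_def HII_edge_def split: if_splits)
  have "HII_edge k 1 \<noteq> HII_edge k 2"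
    using inj_HII_edge[OF assms(1)] by (auto dest: injD)
  then show "degree (HII_edges k m) Twin = 2"
    unfolding degree_def T by simp
  assume "Private i j \<in> HII_vertices k m"
  then obtain l where l: "l \<in> {1..m}" "Private i j \<in> HII_edge k l"
    by (auto simp: HII_vertices_def HII_edges_def)
  have P: "Private i j \<in> HII_edge k l' \<Longrightarrow> l' = i" for l'
    by (auto simp: HII_edge_def split: if_splits)
  have "{e \<in> HII_edges k m. Private i j \<in> e} = {HII_edge k i}"
    using l P[OF l(2)] P by (auto simp: HII_edges_def)
  then show "degree (HII_edges k m) (Private i j) = 1"
    by (simp add: degree_def)
qed

lemma connected_HII:
  assumes "k \<ge> 3" "m \<ge> 2"
  shows "connected_hypergraph (HII_vertices k m) (HII_edges k m)"
  unfolding connected_hypergraph_def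
proof (intro ballI)
  fix u v assume u: "u \<in> HII_vertices k m" and v: "v \<in> HII_vertices k m"
  then obtain e f where e: "e \<in> HII_edges k m" "u \<in> e" and f: "f \<in> HII_edges k m" "v \<in> f"
    by (auto simp: HII_vertices_def)
  have H: "Hub \<in> e" "Hub \<in> f" using e f by (auto simp: HII_edges_def HII_edge_def)
  then have "Hub \<in> HII_vertices k m" using e by (auto simp: HII_vertices_def)
  then have "walk (HII_vertices k m) (HII_edges k m) [u, Hub, v] [e, f]"
    using e f u v H by (auto simp: walk_def less_Suc_eq)
  then show "\<exists>vs es. walk (HII_vertices k m) (HII_edges k m) vs es \<and> hd vs = u \<and> last vs = v"
    by (intro exI[of _ "[u, Hub, v]"] exI[of _ "[e, f]"]) simp
qed

lemma cycle_two_edges: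
  assumes "cycle V E vs es" "v \<in> set vs"
  obtains e f where "e \<in> E" "f \<in> E" "e \<noteq> f" "v \<in> e" "v \<in> f"
proof -
  let ?l = "length es"
  from assms have l: "2 \<le> ?l" "length vs = Suc ?l" "set es \<subseteq> E" "distinct es"
    and hl: "hd vs = last vs"
    and inc: "\<And>i. i < ?l \<Longrightarrow> vs ! i \<in> es ! i" "\<And>i. i < ?l \<Longrightarrow> vs ! Suc i \<in> es ! i"
    by (auto simp: cycle_def walk_def)
  have ends: "vs ! 0 = vs ! ?l"
    using hl l by (metis diff_Suc_1 hd_conv_nth last_conv_nth length_0_conv nat.distinct(1))
  have esE: "es ! i \<in> E" if "i < ?l" for i using l that by (meson nth_mem subsetD)
  from assms(2) l obtain i where i: "i \<le> ?l" "v = vs ! i"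
    by (metis in_set_conv_nth less_Suc_eq_le)
  show thesis
  proof (cases "i = 0 \<or> i = ?l")
    case True
    then have "v \<in> es ! 0" "v \<in> es ! (?l - 1)"
    proof -
      have "0 < ?l" "?l - 1 < ?l" "Suc (?l - 1) = ?l" using l by linarith+
      then show "v \<in> es ! 0" "v \<in> es ! (?l - 1)"
        using True i ends inc(1)[of 0] inc(2)[of "?l - 1"] by metis+
    qed
    moreover have "es ! 0 \<noteq> es ! (?l - 1)" using l by (subst nth_eq_iff_index_eq) auto
    moreover have "es ! 0 \<in> E" "es ! (?l - 1) \<in> E" using l by (intro esE; linarith)+
    ultimately show thesis by (intro that[of "es ! 0" "es ! (?l - 1)"])
  next
    case False
    then obtain j where j: "i = Suc j" by (cases i) auto
    have "v \<in> es ! i" "v \<in> es ! j" using inc False i j by auto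
    moreover have "es ! i \<noteq> es ! j" using l False i j by (subst nth_eq_iff_index_eq) auto
    moreover have "es ! i \<in> E" "es ! j \<in> E" using False i j by (intro esE; simp)+
    ultimately show thesis by (intro that[of "es ! i" "es ! j"])
  qed
qed

lemma unicyclic_HII:
  assumes "k \<ge> 3" "m \<ge> 2"
  shows "unicyclic_hypergraph (HII_vertices k m) (HII_edges k m)"
proof -
  let ?V = "HII_vertices k m" and ?E = "HII_edges k m"
  let ?a = "HII_edge k 1" and ?b = "HII_edge k 2"
  have ab: "?a \<noteq> ?b" using inj_HII_edge[OF assms(1)] by (auto dest: injD)
  have abE: "?a \<in> ?E" "?b \<in> ?E" using assms by (auto simp: HII_edges_def)
  have HT: "Hub \<in> ?a" "Hub \<in> ?b" "Twin \<in> ?a" "Twin \<in> ?b" by (auto simp: HII_edge_def)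
  have "cycle ?V ?E [Hub, Twin, Hub] [?a, ?b]"
    using ab abE HT by (auto simp: cycle_def walk_def less_Suc_eq HII_vertices_def)
  moreover have "walk_incidences [Hub, Twin, Hub] [?a, ?b] = {Hub, Twin} \<times> {?a, ?b}"
    by (auto simp: walk_incidences_def lessThan_Suc)
  moreover have "walk_incidences vs es = {Hub, Twin} \<times> {?a, ?b}" if c: "cycle ?V ?E vs es" for vs es
  proof -
    have "set vs \<subseteq> {Hub, Twin}"
    proof
      fix v assume v: "v \<in> set vs"
      obtain e f where ef: "e \<in> ?E" "f \<in> ?E" "e \<noteq> f" "v \<in> e" "v \<in> f"
        using cycle_two_edges[OF c v] .
      then show "v \<in> {Hub, Twin}"
        by (cases v) (auto simp: HII_edges_def HII_edge_def split: if_splits)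
    qed
    then have sub: "set (butlast vs) \<subseteq> {Hub, Twin}" by (meson in_set_butlastD subset_iff)
    have "length (butlast vs) \<le> card {Hub, Twin}"
      using c sub by (metis card_mono cycle_def distinct_card finite.emptyI finite.insertI)
    then have "length es = 2" using c by (auto simp: cycle_def walk_def)
    then obtain e f where es: "es = [e, f]" by (auto simp: length_Suc_conv numeral_2_eq_2)
    have "length vs = 3" using c es by (auto simp: cycle_def walk_def)
    then obtain x y z where vs: "vs = [x, y, z]" by (auto simp: length_Suc_conv numeral_3_eq_3)
    have xy: "z = x" "x \<noteq> y" "x \<in> {Hub, Twin}" "y \<in> {Hub, Twin}" "e \<noteq> f" "e \<in> ?E" "f \<in> ?E"
      using c sub by (auto simp: cycle_def walk_def es vs)
    have "x \<in> e" "y \<in> e" "y \<in> f" "z \<in> f"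
      using c by (auto simp: cycle_def walk_def es vs less_Suc_eq)
    then have "Twin \<in> e" "Twin \<in> f" using xy by auto
    then have "e \<in> {?a, ?b}" "f \<in> {?a, ?b}"
      unfolding degree_HII(2)[OF assms, symmetric] using xy by simp_all
    then have "{e, f} = {?a, ?b}" using \<open>e \<noteq> f\<close> by fastforce
    moreover have "{x, y} = {Hub, Twin}" using xy by auto
    moreover have "walk_incidences vs es = {x, y} \<times> {e, f}"
      using xy(1) by (auto simp: walk_incidences_def lessThan_Suc es vs)
    ultimately show ?thesis by simp
  qed
  ultimately show ?thesis
    unfolding unicyclic_hypergraph_def using connected_HII[OF assms]
    by (intro conjI ex1I[of _ "{Hub, Twin} \<times> {?a, ?b}"]) blast+
qed

end

theory Submission
  imports Defs
begin

text \<open>The degrees of \<open>\<H>\<close> sum to \<open>k m\<close>, so \<open>I\<^sub>d\<^sup>1 = log (k m) - S / (k m)\<close> with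
  \<open>S = \<Sum> d\<^sub>v log d\<^sub>v\<close>. Since \<open>n = m (k - 1)\<close>, the excess degrees \<open>x\<^sub>v = d\<^sub>v - 1 \<ge> 0\<close> sum to \<open>m\<close>,
  and none of them exceeds \<open>m - 1\<close>. The function \<open>g x = (x + 1) log (x + 1)\<close> is strictly convex
  with \<open>g 0 = 0\<close> and \<open>g 1 = 2\<close>. Hence \<open>g x \<ge> 2 x\<close> on the integers, with equality only for
  \<open>x \<le> 1\<close>, which gives \<open>S \<ge> 2 m\<close>. Conversely, fixing a vertex of excess \<open>a \<ge> 1\<close> and merging
  all the others by superadditivity, \<open>S \<le> g a + g (m - a) \<le> g (m - 1) + g 1\<close>, and equality
  forces the degree sequence \<open>m, 2, 1, \<dots>, 1\<close>, which determines the hypergraph.\<close>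

subsection \<open>Convexity of the shifted entropy function\<close>

text \<open>The shift by one makes vertices of degree 1 contribute nothing and turns convexity into
  superadditivity.\<close>

definition suc_log_suc :: "nat \<Rightarrow> real" where
  "suc_log_suc x = real (Suc x) * log 2 (real (Suc x))"

lemma suc_log_suc_0 [simp]: "suc_log_suc 0 = 0"
  by (simp add: suc_log_suc_def)

lemma suc_log_suc_1 [simp]: "suc_log_suc (Suc 0) = 2"
  by (simp add: suc_log_suc_def)

text \<open>Strict tangent-line inequality for \<open>t * ln t\<close> at \<open>y\<close>, obtained
  from \<open>ln z < z - 1\<close> at \<open>z = y / x\<close>, which differs from 1.\<close>

lemma mult_ln_tangent_less:
  fixes x y :: real
  assumes "x > 0" "y > 0" "x \<noteq> y"
  shows "x * ln y + (x - y) < x * ln x"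
proof -
  have "ln (y / x) < y / x - 1"
    using assms ln_le_minus_one[of "y / x"] ln_eq_minus_one[of "y / x"]
    by (cases "ln (y / x) = y / x - 1") (auto simp: field_simps)
  then have "x * ln (y / x) < x * (y / x - 1)"
    using assms by (intro mult_strict_left_mono)
  then show ?thesis
    using assms by (simp add: ln_div algebra_simps)
qed

text \<open>Strict midpoint convexity around \<open>t = x + 2\<close>: the tangents at
  \<open>t\<close>, evaluated at \<open>t + 1\<close> and \<open>t - 1\<close>, have linear terms
  that cancel on adding.\<close>

lemma suc_log_suc_increment_less:
  "suc_log_suc (Suc x) - suc_log_suc x < suc_log_suc (Suc (Suc x)) - suc_log_suc (Suc x)"
proof -
  define t where "t = real (Suc (Suc x))"
  have t: "t > 1" by (simp add: t_def)
  have "(t + 1) * ln t + 1 < (t + 1) * ln (t + 1)" "(t - 1) * ln t - 1 < (t - 1) * ln (t - 1)"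
    using mult_ln_tangent_less[of "t + 1" t] mult_ln_tangent_less[of "t - 1" t] t by simp_all
  then have "2 * (t * ln t) < (t + 1) * ln (t + 1) + (t - 1) * ln (t - 1)"
    by (simp add: algebra_simps)
  then have "2 * (t * ln t) / ln 2 < ((t + 1) * ln (t + 1) + (t - 1) * ln (t - 1)) / ln 2"
    by (intro divide_strict_right_mono) auto
  then have "2 * (t * log 2 t) < (t + 1) * log 2 (t + 1) + (t - 1) * log 2 (t - 1)"
    by (simp add: log_def add_divide_distrib)
  moreover have "suc_log_suc (Suc x) = t * log 2 t"
    "suc_log_suc (Suc (Suc x)) = (t + 1) * log 2 (t + 1)"
    "suc_log_suc x = (t - 1) * log 2 (t - 1)"
    by (simp_all add: suc_log_suc_def t_def add_ac)
  ultimately show ?thesis by linarith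
qed

lemma suc_log_suc_increment_strict_mono:
  "strict_mono (\<lambda>x. suc_log_suc (Suc x) - suc_log_suc x)"
  by (simp add: strict_mono_Suc_iff suc_log_suc_increment_less)

text \<open>Both differences telescope into \<open>i\<close> unit increments, which compare term by
  term; \<open>0 < i\<close> keeps the sum nonempty, hence the strictness.\<close>

lemma suc_log_suc_shift_less:
  assumes "p < q" "0 < i"
  shows "suc_log_suc (p + i) - suc_log_suc p < suc_log_suc (q + i) - suc_log_suc q"
proof -
  have increments: "suc_log_suc (r + i) - suc_log_suc r
      = (\<Sum>j<i. suc_log_suc (Suc (r + j)) - suc_log_suc (r + j))" for r
    using sum_lessThan_telescope[of "\<lambda>j. suc_log_suc (r + j)" i] by simp
  show ?thesis
    unfolding increments using assms
    by (intro sum_strict_mono strict_monoD[OF suc_log_suc_increment_strict_mono]) auto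
qed

text \<open>Shifting \<open>c\<close> and \<open>b\<close> by the same amount \<open>a - c\<close>
  pushes a pair apart at constant sum. The case \<open>c = 0\<close> merges two parts;
  \<open>c = 1\<close> yields the extremal split.\<close>

lemma suc_log_suc_spread_less:
  assumes "c < a" "c < b"
  shows "suc_log_suc a + suc_log_suc b < suc_log_suc (a + b - c) + suc_log_suc c"
  using suc_log_suc_shift_less[of c b "a - c"] assms by (simp add: add.commute)

lemma suc_log_suc_superadditive: "suc_log_suc a + suc_log_suc b \<le> suc_log_suc (a + b)"
  using suc_log_suc_spread_less[of 0 a b] by (cases "a = 0 \<or> b = 0") auto

text \<open>The first increment is exactly 2 and all later ones are strictly larger.\<close>

lemma suc_log_suc_ge_double: "2 * real x \<le> suc_log_suc x"
  and suc_log_suc_eq_double_iff: "suc_log_suc x = 2 * real x \<longleftrightarrow> x \<le> 1"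
proof -
  have strict: "2 * real x < suc_log_suc x" if "2 \<le> x" for x
    using that
  proof (induction x rule: dec_induct)
    case base
    show ?case using suc_log_suc_increment_less[of 0] by (simp add: numeral_2_eq_2)
  next
    case (step x)
    have "suc_log_suc 1 - suc_log_suc 0 < suc_log_suc (Suc x) - suc_log_suc x"
      using strict_monoD[OF suc_log_suc_increment_strict_mono, of 0 x] step by simp
    then show ?case using step by simp
  qed
  have small: "x = 0 \<or> x = Suc 0" if "\<not> 2 \<le> x" using that by linarith
  show "2 * real x \<le> suc_log_suc x" using strict[of x] small by fastforce
  show "suc_log_suc x = 2 * real x \<longleftrightarrow> x \<le> 1" using strict[of x] small by fastforce
qed

section \<open>Sums over excesses with a prescribed total\<close>

lemma sum_suc_log_suc_le: "finite A \<Longrightarrow> (\<Sum>u\<in>A. suc_log_suc (x u)) \<le> suc_log_suc (\<Sum>u\<in>A. x u)"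
proof (induction A rule: finite_induct)
  case (insert a A)
  then show ?case using suc_log_suc_superadditive[of "x a" "sum x A"] by simp
qed simp

text \<open>Splitting off \<open>u\<close> leaves two positive parts, and merging those is strict.
  In the equality case this forces a single carrier of the total.\<close>

lemma sum_suc_log_suc_less:
  assumes "finite A" "u \<in> A" "0 < x u" "x u < (\<Sum>u\<in>A. x u)"
  shows "(\<Sum>u\<in>A. suc_log_suc (x u)) < suc_log_suc (\<Sum>u\<in>A. x u)"
proof -
  have total: "(\<Sum>u\<in>A. x u) = x u + (\<Sum>u\<in>A - {u}. x u)"
    using assms by (simp add: sum.remove)
  have "(\<Sum>u\<in>A. suc_log_suc (x u)) \<le> suc_log_suc (x u) + suc_log_suc (\<Sum>u\<in>A - {u}. x u)"
    using assms sum_suc_log_suc_le[of "A - {u}" x] by (simp add: sum.remove)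
  also have "\<dots> < suc_log_suc (\<Sum>u\<in>A. x u)"
    using suc_log_suc_spread_less[of 0 "x u" "\<Sum>u\<in>A - {u}. x u"] assms total by simp
  finally show ?thesis .
qed

lemma sum_suc_log_suc_two_parts:
  fixes x :: "'a \<Rightarrow> nat"
  assumes "finite A" "(\<Sum>u\<in>A. x u) = m" "m \<ge> 2" "\<And>u. u \<in> A \<Longrightarrow> x u \<le> m - 1"
  shows "(\<Sum>u\<in>A. suc_log_suc (x u)) \<le> suc_log_suc (m - 1) + 2" (is "?S \<le> ?B")
    and "(\<Sum>u\<in>A. suc_log_suc (x u)) = suc_log_suc (m - 1) + 2 \<longleftrightarrow>
      (\<exists>v\<in>A. \<exists>w\<in>A. v \<noteq> w \<and> x v = m - 1 \<and> x w = 1 \<and> (\<forall>u\<in>A - {v, w}. x u = 0))"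
      (is "_ \<longleftrightarrow> ?extremal")
proof -
  obtain v where v: "v \<in> A" "0 < x v"
    using assms by (metis gr0I not_numeral_le_zero sum.neutral)
  let ?R = "A - {v}"
  define b where "b = (\<Sum>u\<in>?R. x u)"
  have xvb: "x v + b = m" using assms v by (simp add: b_def sum.remove)
  have b: "0 < b" using xvb assms(3) assms(4)[OF v(1)] by linarith
  have S: "?S = suc_log_suc (x v) + (\<Sum>u\<in>?R. suc_log_suc (x u))"
    using assms v by (simp add: sum.remove)
  have merge: "(\<Sum>u\<in>?R. suc_log_suc (x u)) \<le> suc_log_suc b"
    unfolding b_def using assms by (intro sum_suc_log_suc_le) simp
  have spread: "suc_log_suc (x v) + suc_log_suc b < ?B" if "1 < x v" "1 < b"
    using suc_log_suc_spread_less[OF that] xvb by simp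
  \<comment> \<open>Both parts are positive, so if they are not both above 1, one of them is 1 and
    the split is already the extremal one.\<close>
  have ends: "suc_log_suc (x v) + suc_log_suc b = ?B" if "\<not> (1 < x v \<and> 1 < b)"
  proof -
    have "x v = 1 \<and> b = m - 1 \<or> b = 1 \<and> x v = m - 1" using that v b xvb by linarith
    then show ?thesis by auto
  qed
  show "?S \<le> ?B" using S merge spread ends by fastforce
  show "?S = ?B \<longleftrightarrow> ?extremal"
  proof
    assume eq: "?S = ?B"
    then have "\<not> (1 < x v \<and> 1 < b)" using S merge spread by linarith
    then have cases: "x v = 1 \<and> b = m - 1 \<or> b = 1 \<and> x v = m - 1" using v b xvb by linarith
    obtain w where w: "w \<in> ?R" "0 < x w"
      using b unfolding b_def by (metis gr0I less_irrefl sum.neutral)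
    have "(\<Sum>u\<in>?R. suc_log_suc (x u)) = suc_log_suc b"
      using eq S \<open>\<not> (1 < x v \<and> 1 < b)\<close> ends by linarith
    \<comment> \<open>Merging the vertices other than \<open>v\<close> lost nothing, so
      \<open>w\<close> carries all of \<open>b\<close>.\<close>
    then have "\<not> x w < b"
      using sum_suc_log_suc_less[of ?R w x] assms w unfolding b_def by auto
    moreover have rest: "b = x w + (\<Sum>u\<in>?R - {w}. x u)"
      unfolding b_def using assms w by (simp add: sum.remove)
    ultimately have "x w = b" "(\<Sum>u\<in>?R - {w}. x u) = 0" by linarith+
    then have zero: "\<forall>u\<in>?R - {w}. x u = 0" using assms by simp
    \<comment> \<open>The vertex \<open>v\<close> was an arbitrary one of positive excess, so it may
      turn out to play either role.\<close>
    from cases show ?extremal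
    proof
      assume "x v = 1 \<and> b = m - 1"
      then show ?extremal
        using v w zero \<open>x w = b\<close> by (intro bexI[of _ w] bexI[of _ v]) auto
    next
      assume "b = 1 \<and> x v = m - 1"
      then show ?extremal
        using v w zero \<open>x w = b\<close> by (intro bexI[of _ v] bexI[of _ w]) auto
    qed
  next
    assume ?extremal
    then obtain v w where vw: "v \<in> A" "w \<in> A" "v \<noteq> w" "x v = m - 1" "x w = 1"
      "\<forall>u\<in>A - {v, w}. x u = 0"
      by blast
    have "?S = (\<Sum>u\<in>{v, w}. suc_log_suc (x u))"
      using assms vw by (intro sum.mono_neutral_right) auto
    then show "?S = ?B" using vw by simp
  qed
qed

subsection \<open>Degrees\<close>

lemma uniform_hypergraph_finite_edges:
  "uniform_hypergraph k V E \<Longrightarrow> finite E"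
  unfolding uniform_hypergraph_def by (auto intro: finite_subset[of E "Pow V"])

lemma degree_le_card: "finite E \<Longrightarrow> degree E v \<le> card E"
  unfolding degree_def by (intro card_mono) auto

text \<open>Double counting of the vertex-edge incidences.\<close>

lemma sum_degree_uniform:
  assumes "uniform_hypergraph k V E"
  shows "(\<Sum>v\<in>V. degree E v) = k * card E"
proof -
  have fin: "finite V" "finite E"
    using assms uniform_hypergraph_finite_edges by (auto simp: uniform_hypergraph_def)
  have "(\<Sum>v\<in>V. degree E v) = (\<Sum>v\<in>V. \<Sum>e\<in>E. if v \<in> e then 1 else 0)"
    using fin by (simp add: degree_def sum.If_cases Int_def)
  also have "\<dots> = (\<Sum>e\<in>E. \<Sum>v\<in>V. if v \<in> e then 1 else 0)"
    by (rule sum.swap)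
  also have "\<dots> = (\<Sum>e\<in>E. k)"
  proof (rule sum.cong)
    fix e assume "e \<in> E"
    then have "V \<inter> e = e" "card e = k"
      using assms by (auto simp: uniform_hypergraph_def)
    then show "(\<Sum>v\<in>V. if v \<in> e then 1 else 0) = k"
      using fin by (simp add: sum.If_cases)
  qed simp
  finally show ?thesis by simp
qed

text \<open>A walk from \<open>u\<close> to a different vertex has a first edge, and that edge
  contains \<open>u\<close>.\<close>

lemma connected_hypergraph_degree_pos:
  assumes "connected_hypergraph V E" "finite E" "u \<in> V" "v \<in> V" "u \<noteq> v"
  shows "0 < degree E u"
proof -
  obtain vs es where w: "walk V E vs es" "hd vs = u" "last vs = v"
    using assms unfolding connected_hypergraph_def by blast
  have "es \<noteq> []"
  proof
    assume "es = []"
    then obtain y where "vs = [y]" using w by (auto simp: walk_def length_Suc_conv)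
    then show False using w assms by simp
  qed
  moreover have "vs \<noteq> []" using w by (auto simp: walk_def)
  ultimately have "es ! 0 \<in> E" "u \<in> es ! 0"
    using w by (auto simp: walk_def hd_conv_nth)
  then show ?thesis
    using assms by (auto simp: degree_def card_gt_0_iff)
qed

lemma degree_iso:
  assumes "inj_on f V" "\<forall>e\<in>E. e \<subseteq> V" "v \<in> V"
  shows "degree ((\<lambda>e. f ` e) ` E) (f v) = degree E v"
proof -
  have mem: "f v \<in> f ` e \<longleftrightarrow> v \<in> e" if "e \<in> E" for e
    using assms that by (meson inj_on_image_mem_iff)
  have "{e' \<in> (\<lambda>e. f ` e) ` E. f v \<in> e'} = (\<lambda>e. f ` e) ` {e \<in> E. v \<in> e}"
    using mem by blast
  moreover have "inj_on (\<lambda>e. f ` e) {e \<in> E. v \<in> e}"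
    using assms by (auto simp: inj_on_def[of "\<lambda>e. f ` e"] inj_on_image_eq_iff)
  ultimately show ?thesis
    by (simp add: degree_def card_image)
qed

text \<open>The logarithm of the quotient splits, and since the degrees sum to
  \<open>k * card E\<close>, the part with the denominator collapses to one logarithm.\<close>

lemma degree_entropy_eq:
  assumes "uniform_hypergraph k V E" "k > 0" "card E > 0" "\<And>v. v \<in> V \<Longrightarrow> degree E v > 0"
  shows "degree_entropy V E = log 2 (real k * real (card E))
    - (\<Sum>v\<in>V. suc_log_suc (degree E v - 1)) / (real k * real (card E))"
proof -
  let ?s = "real k * real (card E)"
  have s: "?s > 0" using assms by simp
  have sum: "(\<Sum>u\<in>V. real (degree E u)) = ?s"
    using sum_degree_uniform[OF assms(1)] by (metis of_nat_mult of_nat_sum)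
  have "(\<Sum>v\<in>V. real (degree E v) / ?s * log 2 (real (degree E v) / ?s))
      = (\<Sum>v\<in>V. suc_log_suc (degree E v - 1) / ?s - real (degree E v) * (log 2 ?s / ?s))"
  proof (rule sum.cong)
    fix v assume "v \<in> V"
    then have "degree E v > 0" by (rule assms)
    then show "real (degree E v) / ?s * log 2 (real (degree E v) / ?s)
        = suc_log_suc (degree E v - 1) / ?s - real (degree E v) * (log 2 ?s / ?s)"
      using s by (simp add: suc_log_suc_def log_divide diff_divide_distrib right_diff_distrib)
  qed simp
  also have "\<dots> = (\<Sum>v\<in>V. suc_log_suc (degree E v - 1)) / ?s - ?s * (log 2 ?s / ?s)"
    by (simp only: sum_subtractf sum_divide_distrib sum sum_distrib_right[symmetric])
  also have "\<dots> = (\<Sum>v\<in>V. suc_log_suc (degree E v - 1)) / ?s - log 2 ?s"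
    using assms(2,3) by simp
  finally show ?thesis
    unfolding degree_entropy_def sum by linarith
qed

subsection \<open>The degree sequence characterises the extremal hypergraph\<close>

lemma iso_HII_imp_degrees:
  assumes "k \<ge> 3" "m \<ge> 2" "uniform_hypergraph k V E"
    and "hypergraph_iso V E (HII_vertices k m) (HII_edges k m)"
  shows "\<exists>v\<in>V. \<exists>w\<in>V. v \<noteq> w \<and> degree E v = m \<and> degree E w = 2 \<and>
    (\<forall>u\<in>V - {v, w}. degree E u = 1)"
proof -
  obtain f where f: "bij_betw f V (HII_vertices k m)" "(\<lambda>e. f ` e) ` E = HII_edges k m"
    using assms by (auto simp: hypergraph_iso_def)
  have deg: "degree E u = degree (HII_edges k m) (f u)" if "u \<in> V" for u
    using degree_iso[of f V E u] f assms that
    by (auto simp: bij_betw_def uniform_hypergraph_def)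
  have "HII_edge k 1 \<in> HII_edges k m" using assms by (auto simp: HII_edges_def)
  moreover have "{Hub, Twin} \<subseteq> HII_edge k 1" by (simp add: HII_edge_def)
  ultimately have "Hub \<in> HII_vertices k m" "Twin \<in> HII_vertices k m"
    by (auto simp: HII_vertices_def)
  then obtain v w where vw: "v \<in> V" "f v = Hub" "w \<in> V" "f w = Twin"
    using f by (metis bij_betw_imp_surj_on imageE)
  have "degree E u = 1" if u: "u \<in> V - {v, w}" for u
  proof -
    have "f u \<noteq> Hub" "f u \<noteq> Twin"
      using u vw f by (metis DiffE bij_betw_imp_inj_on inj_onD insertCI)+
    then obtain i j where "f u = Private i j" by (cases "f u") auto
    moreover have "f u \<in> HII_vertices k m" using u f by (auto simp: bij_betw_def)
    ultimately show ?thesis using deg[of u] u degree_HII(4)[OF assms(1,2)] by simp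
  qed
  moreover have "v \<noteq> w" using vw by auto
  ultimately show ?thesis
    using vw deg degree_HII(1,3)[OF assms(1,2)] by (intro bexI[of _ v] bexI[of _ w]) auto
qed

text \<open>The edges are numbered so that those through \<open>w\<close> become 1 and 2. Every
  vertex other than \<open>v\<close> and \<open>w\<close> has a unique edge, so numbering these
  vertices edge by edge gives the isomorphism.\<close>

lemma degrees_imp_iso_HII:
  assumes k: "k \<ge> 3" and m: "m \<ge> 2" and unif: "uniform_hypergraph k V E" and cardE: "card E = m"
    and vw: "v \<in> V" "w \<in> V" "v \<noteq> w" "degree E v = m" "degree E w = 2"
    and priv: "\<And>u. u \<in> V - {v, w} \<Longrightarrow> degree E u = 1"
  shows "hypergraph_iso V E (HII_vertices k m) (HII_edges k m)"
proof -
  have finE: "finite E" by (rule uniform_hypergraph_finite_edges[OF unif])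
  have EV: "e \<subseteq> V" "card e = k" "finite e" if "e \<in> E" for e
    using unif that finite_subset by (auto simp: uniform_hypergraph_def)
  \<comment> \<open>The degree of \<open>v\<close> equals the number of edges.\<close>
  have "{e \<in> E. v \<in> e} = E"
    using vw finE cardE by (intro card_subset_eq) (auto simp: degree_def)
  then have v_all: "v \<in> e" if "e \<in> E" for e using that by blast
  obtain e1 e2 where w_edges: "{e \<in> E. w \<in> e} = {e1, e2}" "e1 \<noteq> e2"
    using vw(5) unfolding degree_def card_2_iff by blast
  have e12: "e1 \<in> E" "e2 \<in> E" using w_edges by blast+
  have "finite (E - {e1, e2})" "card {3..m} = card (E - {e1, e2})"
    using finE cardE e12 w_edges m by (auto simp: card_Diff_subset)
  then obtain h0 where h0: "bij_betw h0 {3..m} (E - {e1, e2})"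
    using finite_same_card_bij[of "{3..m}" "E - {e1, e2}"] by auto
  define h where "h i = (if i = 1 then e1 else if i = 2 then e2 else h0 i)" for i :: nat
  have "bij_betw h {3..m} (E - {e1, e2})"
    using h0 by (rule bij_betw_cong[THEN iffD2, rotated]) (auto simp: h_def)
  moreover have "bij_betw h {1, 2} {e1, e2}"
    using w_edges by (auto simp: bij_betw_def h_def inj_on_def)
  ultimately have "bij_betw h ({1, 2} \<union> {3..m}) ({e1, e2} \<union> (E - {e1, e2}))"
    by (intro bij_betw_combine) auto
  moreover have "{1, 2} \<union> {3..m} = {1..m}" using m by auto
  moreover have "{e1, e2} \<union> (E - {e1, e2}) = E" using e12 by auto
  ultimately have h: "bij_betw h {1..m} E" by simp
  have hE: "h i \<in> E" if "i \<in> {1..m}" for i using h that by (auto simp: bij_betw_def)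
  have h_eq: "h i = h j \<longleftrightarrow> i = j" if "i \<in> {1..m}" "j \<in> {1..m}" for i j
    using bij_betw_imp_inj_on[OF h] that by (rule inj_on_eq_iff)
  have w_iff: "w \<in> h i \<longleftrightarrow> i \<in> {1, 2}" if "i \<in> {1..m}" for i
  proof -
    have "w \<in> h i \<longleftrightarrow> h i \<in> {e1, e2}"
      unfolding w_edges(1)[symmetric] using hE[OF that] by simp
    also have "\<dots> \<longleftrightarrow> h i \<in> {h 1, h 2}"
      by (simp add: h_def)
    also have "\<dots> \<longleftrightarrow> i \<in> {1, 2}"
      using h_eq[OF that, of 1] h_eq[OF that, of 2] m by auto
    finally show ?thesis .
  qed
  have cover: "\<exists>i\<in>{1..m}. u \<in> h i" if "u \<in> V" for u
  proof -
    have "degree E u > 0" using that priv[of u] vw m by (cases "u \<in> {v, w}") auto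
    then obtain e where "e \<in> E" "u \<in> e" by (auto simp: degree_def card_gt_0_iff)
    then show ?thesis using h by (auto simp: bij_betw_def)
  qed
  have unique: "i = j" if u: "u \<in> V - {v, w}"
    and ij: "i \<in> {1..m}" "j \<in> {1..m}" "u \<in> h i" "u \<in> h j" for u i j
  proof -
    obtain e where e: "{e \<in> E. u \<in> e} = {e}"
      using priv[OF u] unfolding degree_def by (rule card_1_singletonE)
    have "h i \<in> {e \<in> E. u \<in> e}" "h j \<in> {e \<in> E. u \<in> e}" using ij hE by auto
    then have "h i = h j" unfolding e by simp
    then show ?thesis using h_eq ij by blast
  qed
  \<comment> \<open>The number of vertices of edge \<open>i\<close> other than the hub and the
    twin.\<close>
  define c where "c i = (if i \<in> {1, 2} then k - 2 else k - 1)" for i :: nat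
  have edge: "HII_edge k i = (if i \<in> {1, 2} then {Hub, Twin} else {Hub}) \<union> Private i ` {..<c i}" for i
    by (auto simp: HII_edge_def c_def)
  have "\<exists>q. bij_betw q (h i - {v, w}) {..<c i}" if i: "i \<in> {1..m}" for i
  proof -
    have "card (h i - {v, w}) = c i"
    proof (cases "i \<in> {1, 2}")
      case True
      then have "{v, w} \<subseteq> h i" using w_iff[OF i] v_all[OF hE[OF i]] by simp
      then show ?thesis
        using True EV[OF hE[OF i]] vw by (simp add: card_Diff_subset c_def)
    next
      case False
      then have "h i - {v, w} = h i - {v}" using w_iff[OF i] by auto
      then show ?thesis
        using False EV[OF hE[OF i]] v_all[OF hE[OF i]] by (simp add: c_def)
    qed
    then show ?thesis
      using EV[OF hE[OF i]] finite_same_card_bij[of "h i - {v, w}" "{..<c i}"] by auto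
  qed
  then obtain q where q: "\<And>i. i \<in> {1..m} \<Longrightarrow> bij_betw (q i) (h i - {v, w}) {..<c i}"
    by metis
  \<comment> \<open>For \<open>v\<close> and \<open>w\<close> the choice is ambiguous, but
    \<open>f\<close> consults \<open>idx\<close> only at the other vertices, where it is
    forced.\<close>
  define idx where "idx u = (SOME i. i \<in> {1..m} \<and> u \<in> h i)" for u
  have idx: "idx u \<in> {1..m} \<and> u \<in> h (idx u)" if "u \<in> V" for u
    unfolding idx_def using someI_ex[of "\<lambda>i. i \<in> {1..m} \<and> u \<in> h i"] cover[OF that] by blast
  have idx_eq: "idx u = i" if "i \<in> {1..m}" "u \<in> h i - {v, w}" for u i
  proof -
    have "u \<in> V" using that hE EV by blast
    then show ?thesis using unique[of u "idx u" i] idx[of u] that by blast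
  qed
  define f where "f u = (if u = v then Hub else if u = w then Twin else Private (idx u) (q (idx u) u))"
    for u
  have f_edge: "f ` h i = HII_edge k i" if i: "i \<in> {1..m}" for i
  proof -
    have "f ` (h i - {v, w}) = (\<lambda>u. Private i (q i u)) ` (h i - {v, w})"
      using idx_eq[OF i] by (intro image_cong) (auto simp: f_def)
    also have "\<dots> = Private i ` {..<c i}"
      using bij_betw_imp_surj_on[OF q[OF i]] by (simp add: image_image[symmetric])
    finally have "f ` (h i - {v, w}) = Private i ` {..<c i}" .
    moreover have "h i = (if i \<in> {1, 2} then {v, w} else {v}) \<union> (h i - {v, w})"
      using w_iff[OF i] v_all[OF hE[OF i]] by auto
    ultimately have "f ` h i = f ` (if i \<in> {1, 2} then {v, w} else {v}) \<union> Private i ` {..<c i}"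
      by (metis image_Un)
    moreover have "f v = Hub" "f w = Twin" using vw by (auto simp: f_def)
    ultimately show ?thesis by (simp add: edge)
  qed
  have "(\<lambda>e. f ` e) ` E = (\<lambda>i. f ` h i) ` {1..m}"
    using bij_betw_imp_surj_on[OF h] by (auto simp: image_image)
  then have edges: "(\<lambda>e. f ` e) ` E = HII_edges k m"
    using f_edge by (simp add: HII_edges_def)
  \<comment> \<open>The model's vertex set is the union of its edges, so surjectivity requires that
    no vertex is isolated.\<close>
  have "V = \<Union> E"
    using cover hE EV(1) by blast
  then have "f ` V = HII_vertices k m"
    by (simp add: HII_vertices_def edges[symmetric] image_Union)
  moreover have "inj_on f V"
  proof (rule inj_onI)
    fix u u' assume u: "u \<in> V" "u' \<in> V" "f u = f u'"
    show "u = u'"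
    proof (cases "u \<in> {v, w} \<or> u' \<in> {v, w}")
      case True
      then show ?thesis using u(3) by (auto simp: f_def split: if_splits)
    next
      case False
      then have "idx u = idx u'" "q (idx u) u = q (idx u) u'" using u(3) by (auto simp: f_def)
      then show ?thesis
        using inj_onD[OF bij_betw_imp_inj_on[OF q], of "idx u" u u'] idx[OF u(1)] idx[OF u(2)] False
        by simp
    qed
  qed
  ultimately show ?thesis
    using edges by (auto simp: hypergraph_iso_def bij_betw_def)
qed

section \<open>The entropy bounds and their equality cases\<close>

theorem theorem2:
  fixes V :: "'a set" and E :: "'a set set" and k m n :: nat
  assumes "k \<ge> 3" and "m \<ge> 2"
    and "uniform_hypergraph k V E"
    and "unicyclic_hypergraph V E"
    and "card V = n" and "card E = m"
    and "real m = real n / (real k - 1)"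
  shows "log 2 (real k * real m) - (real m * log 2 (real m) + 2 * log 2 2) / (real k * real m)
           \<le> degree_entropy V E
       \<and> degree_entropy V E \<le> log 2 (real k * real m) - 2 * log 2 2 / real k
       \<and> (log 2 (real k * real m) - (real m * log 2 (real m) + 2 * log 2 2) / (real k * real m)
             = degree_entropy V E
           \<longleftrightarrow> hypergraph_iso V E (HII_vertices k m) (HII_edges k m))
       \<and> (degree_entropy V E = log 2 (real k * real m) - 2 * log 2 2 / real k
           \<longleftrightarrow> Max (degree E ` V) = 2)"
proof -
  note k = assms(1) and m = assms(2) and unif = assms(3)
  have finV: "finite V" and finE: "finite E"
    using unif uniform_hypergraph_finite_edges by (auto simp: uniform_hypergraph_def)
  have "real n + real m = real (k * m)"
    using assms(7) k by (simp add: field_simps)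
  then have n: "n + m = k * m" by linarith
  \<comment> \<open>Gives \<open>n \<ge> 2 * m\<close>, so every vertex has another one to be joined
    to and thus positive degree.\<close>
  have "3 * m \<le> k * m" using k by simp
  then have cardV: "card V > 1" using n m assms(5) by linarith
  have pos: "degree E u > 0" if u: "u \<in> V" for u
  proof -
    have "V \<noteq> {u}" using cardV by auto
    then obtain v where "v \<in> V" "u \<noteq> v" using u by blast
    then show ?thesis
      using connected_hypergraph_degree_pos finE u assms(4)
      by (metis unicyclic_hypergraph_def)
  qed
  define x where "x u = degree E u - 1" for u
  have x: "degree E u = Suc (x u)" if "u \<in> V" for u using pos[OF that] by (simp add: x_def)
  \<comment> \<open>Here the edge count enters: the degree sum exceeds \<open>n\<close> by exactly
    \<open>m\<close>.\<close>
  have "(\<Sum>u\<in>V. x u) + n = k * m"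
    using sum_degree_uniform[OF unif] assms(5,6) by (simp add: x sum.distrib sum_Suc)
  then have sum_x: "(\<Sum>u\<in>V. x u) = m" using n by linarith
  have x_le: "x u \<le> m - 1" if "u \<in> V" for u
    using degree_le_card[OF finE, of u] x[OF that] assms(6) by linarith
  define S where "S = (\<Sum>u\<in>V. suc_log_suc (x u))"
  define s where "s = real k * real m"
  have s: "s > 0" using k m by (simp add: s_def)
  have entropy: "degree_entropy V E = log 2 s - S / s"
    using degree_entropy_eq[OF unif _ _ pos] k m assms(6) by (simp add: S_def s_def x_def)
  have top: "real m * log 2 (real m) + 2 * log 2 2 = suc_log_suc (m - 1) + 2"
    using m by (simp add: suc_log_suc_def)
  have bot: "2 * log 2 2 / real k = 2 * real m / s"
    using k m by (simp add: s_def)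
  have extremal: "(\<exists>v\<in>V. \<exists>w\<in>V. v \<noteq> w \<and> x v = m - 1 \<and> x w = 1 \<and> (\<forall>u\<in>V - {v, w}. x u = 0))
      \<longleftrightarrow> hypergraph_iso V E (HII_vertices k m) (HII_edges k m)"
  proof
    assume "\<exists>v\<in>V. \<exists>w\<in>V. v \<noteq> w \<and> x v = m - 1 \<and> x w = 1 \<and> (\<forall>u\<in>V - {v, w}. x u = 0)"
    then obtain v w where "v \<in> V" "w \<in> V" "v \<noteq> w" "x v = m - 1" "x w = 1"
      "\<forall>u\<in>V - {v, w}. x u = 0" by blast
    then show "hypergraph_iso V E (HII_vertices k m) (HII_edges k m)"
      using m by (intro degrees_imp_iso_HII[OF k m unif assms(6), of v w]) (auto simp: x)
  next
    assume "hypergraph_iso V E (HII_vertices k m) (HII_edges k m)"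
    from iso_HII_imp_degrees[OF k m unif this]
    obtain v w where "v \<in> V" "w \<in> V" "v \<noteq> w" "degree E v = m" "degree E w = 2"
      "\<forall>u\<in>V - {v, w}. degree E u = 1" by blast
    then show "\<exists>v\<in>V. \<exists>w\<in>V. v \<noteq> w \<and> x v = m - 1 \<and> x w = 1 \<and> (\<forall>u\<in>V - {v, w}. x u = 0)"
      by (intro bexI[of _ v] bexI[of _ w]) (auto simp: x_def)
  qed
  \<comment> \<open>\<open>upper\<close> and \<open>lower\<close> bound \<open>S\<close>; the
    entropy decreases in \<open>S\<close>, so they give the lower and the upper entropy bound
    respectively.\<close>
  note upper = sum_suc_log_suc_two_parts[OF finV sum_x m x_le, folded S_def]
  have sum2: "2 * real m = (\<Sum>u\<in>V. 2 * real (x u))"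
    by (simp add: sum_x[symmetric] sum_distrib_left)
  have lower: "2 * real m \<le> S"
    unfolding sum2 S_def by (intro sum_mono suc_log_suc_ge_double)
  have "S = 2 * real m \<longleftrightarrow> (\<Sum>u\<in>V. suc_log_suc (x u) - 2 * real (x u)) = 0"
    by (simp add: sum2 S_def sum_subtractf)
  \<comment> \<open>All summands are nonnegative, so the sum vanishes only if each of them
    does.\<close>
  also have "\<dots> \<longleftrightarrow> (\<forall>u\<in>V. x u \<le> 1)"
    using finV by (subst sum_nonneg_eq_0_iff) (auto simp: suc_log_suc_ge_double suc_log_suc_eq_double_iff)
  also have "\<dots> \<longleftrightarrow> Max (degree E ` V) = 2"
  proof
    assume le: "\<forall>u\<in>V. x u \<le> 1"
    \<comment> \<open>The total excess is positive, so the value 2 is attained and the maximum is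
      not 1.\<close>
    obtain v where "v \<in> V" "x v \<noteq> 0" using sum_x m by (metis not_numeral_le_zero sum.neutral)
    then have "2 = degree E v" "v \<in> V" using le x by fastforce+
    then show "Max (degree E ` V) = 2"
      using finV le by (intro Max_eqI) (auto simp: x)
  next
    assume max: "Max (degree E ` V) = 2"
    have "degree E u \<le> 2" if "u \<in> V" for u
      unfolding max[symmetric] using finV that by (intro Max_ge) auto
    then show "\<forall>u\<in>V. x u \<le> 1" by (fastforce simp: x)
  qed
  finally have eq_bot: "S = 2 * real m \<longleftrightarrow> Max (degree E ` V) = 2" .
  show ?thesis
    unfolding s_def[symmetric] entropy top bot
  proof (intro conjI)
    show "log 2 s - (suc_log_suc (m - 1) + 2) / s \<le> log 2 s - S / s"
      using divide_right_mono[OF upper(1), of s] s by simp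
    show "log 2 s - S / s \<le> log 2 s - 2 * real m / s"
      using divide_right_mono[OF lower, of s] s by simp
    have "log 2 s - (suc_log_suc (m - 1) + 2) / s = log 2 s - S / s
        \<longleftrightarrow> S = suc_log_suc (m - 1) + 2"
      using s by auto
    then show "log 2 s - (suc_log_suc (m - 1) + 2) / s = log 2 s - S / s
        \<longleftrightarrow> hypergraph_iso V E (HII_vertices k m) (HII_edges k m)"
      using upper(2) extremal by simp
    have "log 2 s - S / s = log 2 s - 2 * real m / s \<longleftrightarrow> S = 2 * real m"
      using s by auto
    then show "log 2 s - S / s = log 2 s - 2 * real m / s \<longleftrightarrow> Max (degree E ` V) = 2"
      using eq_bot by simp
  qed
qed

end
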